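(* (1) $\chi_{NL}(P_2)=2$. (2) $\chi_{NL}(P_n)=3$ for $3\le n\le 9$. (3) $\chi_{NL}(C_n)=3$ for $n\in\{3,5,7,9\}$. (4) $\chi_{NL}(C_n)=4$ for $n\in\{4,6,8\}$. Here $P_n$ and $C_n$ denote the path and the cycle of order $n$.
   Context: All graphs are finite, simple, undirected and connected. A $k$-coloring of a graph $G$ is a partition of $V(G)$ into $k$ independent sets (colors). A coloring $\{S_1,\dots,S_k\}$ is neighbor-locating (an NL-coloring) if for any two distinct vertices $u,v$ in the same color class, $\{j: N(u)\cap S_j\neq\emptyset\}\neq\{j: N(v)\cap S_j\neq\emptyset\}$. The neighbor-locating chromatic number $\chi_{NL}(G)$ is the minimum number of colors in an NL-coloring of $G$. *)

theory Defs
  imports "Graph_Theory.Graph_Theory" "HOL-Library.Disjoint_Sets"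
begin

text \<open>
  A finite simple undirected graph is a digraph satisfying \<^locale>\<open>pair_graph\<close>: the edge
  \<open>uv\<close> is represented by the two arcs \<open>(u, v)\<close> and \<open>(v, u)\<close>.
\<close>

definition neighborhood :: "'a pair_pre_digraph \<Rightarrow> 'a \<Rightarrow> 'a set" where
  "neighborhood G v = {w. (v, w) \<in> parcs G}"

definition independent_in :: "'a pair_pre_digraph \<Rightarrow> 'a set \<Rightarrow> bool" where
  "independent_in G S \<longleftrightarrow> S \<subseteq> pverts G \<and> (\<forall>u\<in>S. \<forall>v\<in>S. (u, v) \<notin> parcs G)"

text \<open>The color classes of a coloring are nonempty, as \<^const>\<open>partition_on\<close> excludes the empty set.\<close>

definition coloring :: "'a pair_pre_digraph \<Rightarrow> nat \<Rightarrow> 'a set set \<Rightarrow> bool" where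
  "coloring G k P \<longleftrightarrow>
     partition_on (pverts G) P \<and> finite P \<and> card P = k \<and> (\<forall>S\<in>P. independent_in G S)"

text \<open>Since the classes are pairwise distinct, a set of color indices is the same as a set of classes.\<close>

definition neighbor_colors :: "'a pair_pre_digraph \<Rightarrow> 'a set set \<Rightarrow> 'a \<Rightarrow> 'a set set" where
  "neighbor_colors G P v = {S \<in> P. neighborhood G v \<inter> S \<noteq> {}}"

definition nl_coloring :: "'a pair_pre_digraph \<Rightarrow> nat \<Rightarrow> 'a set set \<Rightarrow> bool" where
  "nl_coloring G k P \<longleftrightarrow> coloring G k P \<and>
     (\<forall>S\<in>P. \<forall>u\<in>S. \<forall>v\<in>S. u \<noteq> v \<longrightarrow> neighbor_colors G P u \<noteq> neighbor_colors G P v)"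

definition chi_NL :: "'a pair_pre_digraph \<Rightarrow> nat" where
  "chi_NL G = (LEAST k. \<exists>P. nl_coloring G k P)"

text \<open>The minimum is attained: coloring each vertex with its own color is neighbor-locating.\<close>

lemma (in pair_graph) nl_coloring_singletons:
  "nl_coloring G (card (pverts G)) ((\<lambda>v. {v}) ` pverts G)"
proof -
  have "(v, v) \<notin> parcs G" for v
    using pair_no_loops[of "(v, v)"] by auto
  moreover have "partition_on (pverts G) ((\<lambda>v. {v}) ` pverts G)"
    by (auto simp: partition_on_def disjoint_def)
  moreover have "card ((\<lambda>v. {v}) ` pverts G) = card (pverts G)"
    by (simp add: card_image)
  ultimately show ?thesis
    using pair_finite_verts by (auto simp: nl_coloring_def coloring_def independent_in_def)
qed

lemma (in pair_graph) chi_NL_attained: "\<exists>P. nl_coloring G (chi_NL G) P"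
  unfolding chi_NL_def using nl_coloring_singletons by (rule LeastI2[OF exI])

definition path_graph :: "nat \<Rightarrow> nat pair_pre_digraph" where
  "path_graph n =
     \<lparr> pverts = {0..<n},
       parcs = {(i, j). i < n \<and> j < n \<and> (j = Suc i \<or> i = Suc j)} \<rparr>"

text \<open>The order of a cycle is at least 3; for smaller \<open>n\<close> the following is not a cycle.\<close>

definition cycle_graph :: "nat \<Rightarrow> nat pair_pre_digraph" where
  "cycle_graph n =
     \<lparr> pverts = {0..<n},
       parcs = {(i, j). i < n \<and> j < n \<and> (j = Suc i mod n \<or> i = Suc j mod n)} \<rparr>"

lemma pair_graph_path_graph: "pair_graph (path_graph n)"
proof -
  have "finite (parcs (path_graph n))"
    by (rule finite_subset[of _ "{0..<n} \<times> {0..<n}"]) (auto simp: path_graph_def)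
  then show ?thesis
    by unfold_locales (auto simp: path_graph_def symmetric_def sym_def)
qed

lemma pair_graph_cycle_graph:
  assumes "n \<ge> 3"
  shows "pair_graph (cycle_graph n)"
proof -
  have "finite (parcs (cycle_graph n))"
    by (rule finite_subset[of _ "{0..<n} \<times> {0..<n}"]) (auto simp: cycle_graph_def)
  moreover have "Suc i mod n \<noteq> i" if "i < n" for i
    using that assms by (cases "Suc i = n") auto
  ultimately show ?thesis
    by unfold_locales (force simp: cycle_graph_def symmetric_def sym_def)+
qed

lemma connected_from_zero:
  fixes G :: "nat pair_pre_digraph"
  assumes G: "pair_graph G" and verts: "pverts G = {0..<n}" and "n > 0"
    and step: "\<And>i. Suc i < n \<Longrightarrow> (i, Suc i) \<in> parcs G"
  shows "connected (with_proj G)"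
proof -
  interpret pair_graph G by fact
  have *: "0 \<rightarrow>\<^sup>*\<^bsub>with_proj G\<^esub> i" if "i < n" for i
    using that
  proof (induction i)
    case 0
    then show ?case using verts by (auto intro: reachable_refl)
  next
    case (Suc i)
    then have "0 \<rightarrow>\<^sup>*\<^bsub>with_proj G\<^esub> i" "(i, Suc i) \<in> parcs G"
      using step by auto
    then show ?case by (rule reachable_adj_trans)
  qed
  have "i \<rightarrow>\<^sup>*\<^bsub>with_proj G\<^esub> j" if "i < n" "j < n" for i j
    using *[OF that(1)] *[OF that(2)] symmetric_reachable[OF sym_arcs] reachable_trans by blast
  then show ?thesis
    using verts \<open>n > 0\<close>
    by (auto simp: connected_def strongly_connected_def intro!: reachable_mk_symmetricI)
qed

lemma connected_path_graph: "n > 0 \<Longrightarrow> connected (with_proj (path_graph n))"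
  by (rule connected_from_zero[OF pair_graph_path_graph]) (auto simp: path_graph_def)

lemma connected_cycle_graph: "n \<ge> 3 \<Longrightarrow> connected (with_proj (cycle_graph n))"
  by (rule connected_from_zero[OF pair_graph_cycle_graph]) (auto simp: cycle_graph_def)

end

theory Submission
  imports Defs
begin

text \<open>
  With at most two colors all vertices of a class see the same set of colors, so every class of an
  NL-coloring is a singleton. This gives the lower bound 3 for every graph of order at least 3
  without isolated vertices.

  The lower bound 4 for even cycles is a parity argument, valid for all 2-regular graphs. In an
  NL-coloring with classes \<open>A\<close>, \<open>B\<close>, \<open>C\<close> every class contains at most one vertex that sees both
  other colors. The number of edges between \<open>A\<close> and \<open>B\<close> is odd iff \<open>A\<close> contains such a vertex, and,
  by symmetry, iff \<open>B\<close> does. Hence all three classes contain such a vertex or none does. The second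
  case is impossible: the two neighbors of a vertex have the same color only if they see different
  sets of colors, so one of them sees both other colors. Therefore the three numbers of edges
  between the classes are odd, and so is their sum, the number of edges, which is the order.
\<close>

section \<open>Neighborhoods, and colorings given by functions\<close>

lemma chi_NL_eqI:
  assumes "nl_coloring G k P" "\<And>j Q. j < k \<Longrightarrow> \<not> nl_coloring G j Q"
  shows "chi_NL G = k"
  unfolding chi_NL_def using assms by (intro Least_equality) (auto simp: not_less[symmetric])

lemma (in pair_graph) neighborhood_subset: "neighborhood G v \<subseteq> pverts G"
  by (auto simp: neighborhood_def dest: in_arcsD2)

lemma (in pair_graph) neighborhood_sym: "u \<in> neighborhood G v \<longleftrightarrow> v \<in> neighborhood G u"
  unfolding neighborhood_def using arcs_symmetric by blast

lemma (in pair_graph) nl_coloring_fibres: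
  assumes proper: "\<And>v. v \<in> pverts G \<Longrightarrow> c v \<notin> c ` neighborhood G v"
    and locating: "\<And>u v. \<lbrakk>u \<in> pverts G; v \<in> pverts G; u \<noteq> v; c u = c v\<rbrakk> \<Longrightarrow>
      c ` neighborhood G u \<noteq> c ` neighborhood G v"
  shows "nl_coloring G (card (c ` pverts G)) ((\<lambda>a. {v \<in> pverts G. c v = a}) ` c ` pverts G)"
proof -
  let ?F = "\<lambda>a. {v \<in> pverts G. c v = a}"
  let ?P = "?F ` c ` pverts G"
  \<comment> \<open>Fibres of attained values are nonempty, so each determines its value.\<close>
  have inj: "inj_on ?F (c ` pverts G)"
    by (rule inj_onI) blast
  have "partition_on (pverts G) ?P"
    by (auto simp: partition_on_def disjoint_def)
  moreover have "independent_in G S" if "S \<in> ?P" for S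
    using that proper by (fastforce simp: independent_in_def neighborhood_def image_iff)
  ultimately have "coloring G (card (c ` pverts G)) ?P"
    using card_image[OF inj] by (simp add: coloring_def)
  moreover have "neighbor_colors G ?P v = ?F ` c ` neighborhood G v" for v
  proof -
    have "neighborhood G v \<inter> ?F a \<noteq> {} \<longleftrightarrow> a \<in> c ` neighborhood G v" for a
      using neighborhood_subset[of v] by blast
    then show ?thesis
      using neighborhood_subset[of v] by (auto simp: neighbor_colors_def)
  qed
  moreover have "c ` neighborhood G v \<subseteq> c ` pverts G" for v
    using neighborhood_subset by blast
  ultimately show ?thesis
    using locating by (auto simp: nl_coloring_def inj_on_image_eq_iff[OF inj])
qed

section \<open>Classes seen by a vertex, and the case of at most two colors\<close>

lemma nl_coloring_neighbor_colors:
  assumes P: "nl_coloring G k P" and S: "S \<in> P" "v \<in> S"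
  shows "neighbor_colors G P v \<subseteq> P - {S}"
  using assms by (auto simp: nl_coloring_def coloring_def independent_in_def neighbor_colors_def
    neighborhood_def)

lemma nl_coloring_eqI:
  assumes "nl_coloring G k P" "S \<in> P" "u \<in> S" "v \<in> S"
    and "neighbor_colors G P u = neighbor_colors G P v"
  shows "u = v"
  using assms unfolding nl_coloring_def by metis

text \<open>Stated as an equality so that any order above \<open>k\<close> refutes the
  coloring.\<close>

lemma (in pair_graph) nl_coloring_le_2:
  assumes P: "nl_coloring G k P" and "k \<le> 2"
    and isolated: "\<And>v. v \<in> pverts G \<Longrightarrow> neighborhood G v \<noteq> {}"
  shows "card (pverts G) = k"
proof -
  have part: "partition_on (pverts G) P" and fin: "finite P" and k: "card P = k"
    using P by (auto simp: nl_coloring_def coloring_def)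
  \<comment> \<open>\<open>P - {S}\<close> has at most one element, and \<open>v\<close> sees a
    nonempty part of it because it has a neighbor.\<close>
  have colors: "neighbor_colors G P v = P - {S}" if S: "S \<in> P" "v \<in> S" for S v
  proof -
    have "v \<in> pverts G"
      using S part by (auto simp: partition_on_def)
    then obtain w where "w \<in> neighborhood G v"
      using isolated by blast
    moreover from this have "w \<in> \<Union>P"
      using neighborhood_subset part by (auto simp: partition_on_def)
    ultimately have "neighbor_colors G P v \<noteq> {}"
      by (auto simp: neighbor_colors_def)
    then have "card (neighbor_colors G P v) \<noteq> 0"
      using fin by (simp add: neighbor_colors_def)
    moreover have "neighbor_colors G P v \<subseteq> P - {S}"
      using nl_coloring_neighbor_colors[OF P S] .
    moreover have "card (P - {S}) \<le> 1"
      using S k \<open>k \<le> 2\<close> fin by simp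
    ultimately show ?thesis
      using fin by (intro card_seteq) auto
  qed
  have "card S = 1" if S: "S \<in> P" for S
  proof -
    have "S \<noteq> {}"
      using S partition_onD3[OF part] by auto
    moreover have "u = v" if "u \<in> S" "v \<in> S" for u v
      using nl_coloring_eqI[OF P S that] colors[OF S that(1)] colors[OF S that(2)] by simp
    ultimately show ?thesis
      using is_singletonI'[of S] by (simp add: is_singleton_altdef)
  qed
  then have "(\<Sum>S\<in>P. card S) = k"
    using k by simp
  moreover have "card (\<Union>P) = (\<Sum>S\<in>P. card S)"
  proof (rule card_Union_disjoint)
    show "pairwise disjnt P"
      using partition_onD2[OF part] by (simp add: disjoint_def pairwise_def disjnt_def)
    show "finite S" if "S \<in> P" for S
      using that partition_onD1[OF part] pair_finite_verts by (metis Sup_upper finite_subset)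
  qed
  ultimately show ?thesis
    using part by (simp add: partition_on_def)
qed

section \<open>Parity of the order of 2-regular graphs with three colors\<close>

lemma (in pair_graph) odd_order_if_2_regular:
  assumes regular: "\<And>v. v \<in> pverts G \<Longrightarrow> card (neighborhood G v) = 2"
    and "pverts G \<noteq> {}" and P: "nl_coloring G 3 P"
  shows "odd (card (pverts G))"
proof -
  let ?N = "neighborhood G"
  let ?full = "\<lambda>S v. v \<in> S \<and> neighbor_colors G P v = P - {S}"
  \<comment> \<open>For distinct classes each edge between them contributes exactly one such
    arc.\<close>
  define e where "e S T = card {(u, v). u \<in> S \<and> v \<in> T \<and> (u, v) \<in> parcs G}" for S T
  have part: "partition_on (pverts G) P" and card_P: "card P = 3"
    using P by (auto simp: nl_coloring_def coloring_def)
  have fin_N: "finite (?N v)" for v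
    using neighborhood_subset pair_finite_verts by (rule finite_subset)
  have sub: "S \<subseteq> pverts G" if "S \<in> P" for S
    using that part by (auto simp: partition_on_def)
  have fin: "finite S" if "S \<in> P" for S
    using sub[OF that] pair_finite_verts by (rule finite_subset)
  have e_sym: "e S T = e T S" for S T
    unfolding e_def
    by (rule bij_betw_same_card[of prod.swap])
      (auto simp: bij_betw_def inj_on_def image_iff intro: arcs_symmetric)
  have e_sum: "e S T = (\<Sum>u\<in>S. card (?N u \<inter> T))" if "S \<in> P" for S T
  proof -
    have "{(u, v). u \<in> S \<and> v \<in> T \<and> (u, v) \<in> parcs G} = Sigma S (\<lambda>u. ?N u \<inter> T)"
      by (auto simp: neighborhood_def)
    then show ?thesis
      using fin[OF that] fin_N by (simp add: e_def)
  qed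
  have N_split: "card (?N v \<inter> T) + card (?N v \<inter> U) = 2"
    if "P = {S, T, U}" "distinct [S, T, U]" "v \<in> S" for S T U v
  proof -
    have "?N v \<inter> S = {}"
      using nl_coloring_neighbor_colors[OF P, of S v] that by (auto simp: neighbor_colors_def)
    moreover have "T \<inter> U = {}"
      using that part by (auto simp: partition_on_def disjoint_def)
    moreover have "?N v \<subseteq> S \<union> T \<union> U"
      using neighborhood_subset[of v] part that(1) by (auto simp: partition_on_def)
    ultimately have "?N v = (?N v \<inter> T) \<union> (?N v \<inter> U)" "(?N v \<inter> T) \<inter> (?N v \<inter> U) = {}"
      by blast+
    moreover have "card (?N v) = 2"
      using regular sub that by blast
    ultimately show ?thesis
      using fin_N by (metis card_Un_disjoint finite_Int)
  qed
  \<comment> \<open>The two neighbors are distributed over \<open>T\<close> and \<open>U\<close> as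
    2+0, 1+1 or 0+2; only 1+1 is odd, and only there are both classes seen.\<close>
  have full_iff: "odd (card (?N v \<inter> T)) \<longleftrightarrow> ?full S v"
    if "P = {S, T, U}" "distinct [S, T, U]" "v \<in> S" for S T U v
  proof -
    have "?full S v \<longleftrightarrow> ?N v \<inter> T \<noteq> {} \<and> ?N v \<inter> U \<noteq> {}"
      using that nl_coloring_neighbor_colors[OF P, of S v]
      by (auto simp: neighbor_colors_def)
    also have "\<dots> \<longleftrightarrow> card (?N v \<inter> T) \<noteq> 0 \<and> card (?N v \<inter> U) \<noteq> 0"
      using fin_N by simp
    also have "\<dots> \<longleftrightarrow> odd (card (?N v \<inter> T))"
      using N_split[OF that] by presburger
    finally show ?thesis ..
  qed
  \<comment> \<open>The parity of a sum is that of its number of odd terms. Here these terms belong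
    to the full vertices of \<open>S\<close>, of which there is at most one.\<close>
  have e_odd: "odd (e S T) \<longleftrightarrow> (\<exists>v. ?full S v)"
    if STU: "P = {S, T, U}" "distinct [S, T, U]" for S T U
  proof -
    have "S \<in> P"
      using STU(1) by simp
    have "odd (e S T) \<longleftrightarrow> odd (card {v \<in> S. odd (card (?N v \<inter> T))})"
      using e_sum[of S T] fin[of S] STU(1) by (simp add: even_sum_iff)
    also have "{v \<in> S. odd (card (?N v \<inter> T))} = {v. ?full S v}"
      using full_iff[OF STU] by blast
    also have "odd (card {v. ?full S v}) \<longleftrightarrow> (\<exists>v. ?full S v)"
    proof
      assume "\<exists>v. ?full S v"
      then obtain v where v: "?full S v" ..
      have "w = v" if "?full S w" for w
        using nl_coloring_eqI[OF P \<open>S \<in> P\<close>, of w v] v that by simp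
      then have "{v. ?full S v} = {v}"
        using v by blast
      then show "odd (card {v. ?full S v})"
        by simp
    qed (auto dest: odd_card_imp_not_empty)
    finally show ?thesis .
  qed
  have degree_sum: "2 * card S = e S T + e S U"
    if STU: "P = {S, T, U}" "distinct [S, T, U]" for S T U
  proof -
    have "e S T + e S U = (\<Sum>v\<in>S. card (?N v \<inter> T) + card (?N v \<inter> U))"
      using e_sum[of S] STU(1) by (simp add: sum.distrib)
    then show ?thesis
      using N_split[OF STU] by simp
  qed
  have "\<exists>S v. S \<in> P \<and> ?full S v"
  proof -
    obtain u where "u \<in> pverts G"
      using \<open>pverts G \<noteq> {}\<close> by blast
    then obtain S where S: "S \<in> P" "u \<in> S"
      using part by (auto simp: partition_on_def)
    have "card (P - {S}) = 2"
      using card_P S by simp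
    then obtain T U where "P - {S} = {T, U}" "T \<noteq> U"
      by (meson card_2_iff)
    then have STU: "P = {S, T, U}" "distinct [S, T, U]"
      using S by auto
    obtain v w where vw: "?N u = {v, w}" "v \<noteq> w"
      using regular[OF \<open>u \<in> pverts G\<close>] by (meson card_2_iff)
    have sees: "S \<in> neighbor_colors G P x" if "x \<in> ?N u" for x
      using that S neighborhood_sym by (auto simp: neighbor_colors_def)
    \<comment> \<open>Both neighbors of \<open>u\<close> see \<open>S\<close>. If neither were full,
      both would see \<open>S\<close> alone, against the locating condition in
      \<open>T\<close>.\<close>
    have third: "\<exists>x. ?full T x"
      if STU: "P = {S, T, U}" "distinct [S, T, U]" and "?N u \<subseteq> T" for T U
    proof (rule ccontr)
      assume no_full: "\<nexists>x. ?full T x"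
      have "T \<in> P"
        using STU(1) by simp
      have "neighbor_colors G P x = {S}" if "x \<in> ?N u" for x
      proof -
        have "x \<in> T"
          using that \<open>?N u \<subseteq> T\<close> by blast
        moreover have "P - {T} = {S, U}"
          using STU by auto
        ultimately have "neighbor_colors G P x \<subseteq> {S, U}" "neighbor_colors G P x \<noteq> {S, U}"
          using nl_coloring_neighbor_colors[OF P \<open>T \<in> P\<close>, of x] no_full by auto
        then show ?thesis
          using sees[OF that] by blast
      qed
      then have "neighbor_colors G P v = neighbor_colors G P w"
        using vw(1) by simp
      moreover have "v \<in> T" "w \<in> T"
        using vw(1) \<open>?N u \<subseteq> T\<close> by auto
      ultimately show False
        using nl_coloring_eqI[OF P \<open>T \<in> P\<close>] vw(2) by blast
    qed
    have "?N u \<inter> S = {}"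
      using nl_coloring_neighbor_colors[OF P, of S u] S by (auto simp: neighbor_colors_def)
    then have "?N u \<subseteq> T \<union> U"
      using neighborhood_subset[of u] part STU(1) by (auto simp: partition_on_def)
    then consider "?full S u" | "?N u \<subseteq> T" | "?N u \<subseteq> U"
      using nl_coloring_neighbor_colors[OF P, of S u] S STU by (auto simp: neighbor_colors_def)
    then show ?thesis
    proof cases
      case 1
      then show ?thesis using S by blast
    next
      case 2
      then have "\<exists>x. ?full T x" by (rule third[OF STU])
      moreover have "T \<in> P" using STU(1) by simp
      ultimately show ?thesis by blast
    next
      case 3
      have "P = {S, U, T}" "distinct [S, U, T]"
        using STU by auto
      then have "\<exists>x. ?full U x" using 3 by (rule third)
      moreover have "U \<in> P" using STU(1) by simp
      ultimately show ?thesis by blast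
    qed
  qed
  then obtain S\<^sub>0 v\<^sub>0 where full: "S\<^sub>0 \<in> P" "?full S\<^sub>0 v\<^sub>0"
    by blast
  obtain A B C where P_eq: "P = {A, B, C}" and distinct: "A \<noteq> B" "A \<noteq> C" "B \<noteq> C"
    using card_P by (auto simp: card_3_iff)
  \<comment> \<open>Arrangements for which \<open>e_odd\<close> evaluates \<open>e A B\<close> and
    \<open>e A C\<close> from both ends and \<open>e B C\<close> from \<open>B\<close>; this links
    the three classes.\<close>
  have perms: "P = {A, B, C}" "P = {A, C, B}" "P = {B, A, C}" "P = {B, C, A}" "P = {C, A, B}"
    using P_eq by auto
  have dist: "distinct [A, B, C]" "distinct [A, C, B]" "distinct [B, A, C]" "distinct [B, C, A]"
    "distinct [C, A, B]"
    using distinct by auto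
  \<comment> \<open>Hiding the quantifier makes the combination of the parities purely
    propositional.\<close>
  define has_full where "has_full S \<longleftrightarrow> (\<exists>v. ?full S v)" for S
  have "S\<^sub>0 = A \<or> S\<^sub>0 = B \<or> S\<^sub>0 = C"
    using full(1) by (simp add: P_eq)
  moreover have "has_full S\<^sub>0"
    using full(2) by (auto simp: has_full_def)
  ultimately have "has_full A \<or> has_full B \<or> has_full C"
    by auto
  moreover have "odd (e A B) \<longleftrightarrow> has_full A" "odd (e A C) \<longleftrightarrow> has_full A"
    "odd (e A B) \<longleftrightarrow> has_full B" "odd (e B C) \<longleftrightarrow> has_full B" "odd (e A C) \<longleftrightarrow> has_full C"
    unfolding has_full_def
    using e_odd[OF perms(1) dist(1)] e_odd[OF perms(2) dist(2)] e_odd[OF perms(3) dist(3)]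
      e_odd[OF perms(4) dist(4)] e_odd[OF perms(5) dist(5)]
    unfolding e_sym[of B A] e_sym[of C A]
    .
  ultimately have odd: "odd (e A B)" "odd (e A C)" "odd (e B C)"
    by blast+
  have "2 * card A = e A B + e A C" "2 * card B = e A B + e B C" "2 * card C = e A C + e B C"
    using degree_sum[OF perms(1) dist(1)] degree_sum[OF perms(3) dist(3)]
      degree_sum[OF perms(5) dist(5)] e_sym[of B A] e_sym[of C A] e_sym[of C B]
    by simp_all
  moreover have "card (pverts G) = card A + card B + card C"
  proof -
    have "pverts G = A \<union> B \<union> C"
      using part unfolding P_eq partition_on_def by blast
    moreover have "A \<inter> B = {}" "A \<inter> C = {}" "B \<inter> C = {}"
      using disjointD[OF partition_onD2[OF part]] distinct by (simp_all add: P_eq)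
    moreover have "finite A" "finite B" "finite C"
      using fin by (simp_all add: P_eq)
    ultimately show ?thesis
      by (simp add: card_Un_disjoint Int_Un_distrib2)
  qed
  \<comment> \<open>Each of the three numbers occurs in two degree sums, so the factor 2
    cancels.\<close>
  ultimately have "card (pverts G) = e A B + e A C + e B C"
    by linarith
  then show ?thesis
    using odd by simp
qed

section \<open>Neighborhoods in paths and cycles, and colorings given by lists\<close>

lemma neighborhood_path_graph:
  assumes "u < n"
  shows "neighborhood (path_graph n) u =
    (if Suc u < n then {Suc u} else {}) \<union> (if u = 0 then {} else {u - 1})"
  using assms by (auto simp: neighborhood_def path_graph_def)

text \<open>Explicit wrap-around at both ends replaces \<open>mod\<close>, so that concrete
  neighborhoods evaluate by simplification.\<close>

lemma neighborhood_cycle_graph: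
  assumes "u < n"
  shows "neighborhood (cycle_graph n) u =
    {if Suc u = n then 0 else Suc u, if u = 0 then n - 1 else u - 1}"
  using assms by (auto simp: neighborhood_def cycle_graph_def mod_Suc split: if_splits)

lemma card_neighborhood_cycle_graph:
  assumes "n \<ge> 3" "u < n"
  shows "card (neighborhood (cycle_graph n) u) = 2"
proof -
  \<comment> \<open>Successor and predecessor would coincide for \<open>n = 2\<close>.\<close>
  have "(if Suc u = n then 0 else Suc u) \<noteq> (if u = 0 then n - 1 else u - 1)"
    using assms by auto
  then show ?thesis
    unfolding neighborhood_cycle_graph[OF assms(2)] by (simp only: card_2_iff) blast
qed

text \<open>An executable form of the NL-condition, where entry \<open>v\<close> is the color of
  vertex \<open>v\<close>. Bounded quantifiers unfold for concrete lists, and \<open>u < v\<close>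
  tests each pair once.\<close>

definition nl_list :: "(nat \<Rightarrow> nat set) \<Rightarrow> nat list \<Rightarrow> bool" where
  "nl_list N xs \<longleftrightarrow> (\<forall>v<length xs. xs ! v \<notin> (!) xs ` N v \<and>
     (\<forall>u<v. xs ! u = xs ! v \<longrightarrow> (!) xs ` N u \<noteq> (!) xs ` N v))"

lemma nl_coloring_list:
  assumes "pair_graph G" "pverts G = {0..<length xs}" and nl: "nl_list (neighborhood G) xs"
  shows "\<exists>P. nl_coloring G (card (set xs)) P"
proof -
  interpret pair_graph G by fact
  have "(!) xs ` pverts G = set xs"
    using assms(2) by (auto simp: set_conv_nth image_iff)
  moreover have "(!) xs ` neighborhood G u \<noteq> (!) xs ` neighborhood G v"
    if "u < length xs" "v < length xs" "u \<noteq> v" "xs ! u = xs ! v" for u v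
    using nl that unfolding nl_list_def by (metis linorder_neqE_nat)
  ultimately show ?thesis
    using nl_coloring_fibres[of "(!) xs"] assms(2) nl by (auto simp: nl_list_def)
qed

lemma nl_coloring_path_graph:
  assumes "nl_list (neighborhood (path_graph n)) xs" "length xs = n" "card (set xs) = k"
  shows "\<exists>P. nl_coloring (path_graph n) k P"
  using nl_coloring_list[OF pair_graph_path_graph _ assms(1)] assms(2,3)
  by (simp add: path_graph_def)

lemma nl_coloring_cycle_graph:
  assumes "nl_list (neighborhood (cycle_graph n)) xs" "length xs = n" "card (set xs) = k" "n \<ge> 3"
  shows "\<exists>P. nl_coloring (cycle_graph n) k P"
  using nl_coloring_list[OF pair_graph_cycle_graph[OF assms(4)] _ assms(1)] assms(2,3)
  by (simp add: cycle_graph_def)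

text \<open>Unary numerals let \<open>All_less_Suc\<close> enumerate the vertices;
  \<open>doubleton_eq_iff\<close> compares color sets and \<open>card_insert_if\<close> counts
  colors.\<close>

lemmas nl_list_simps = nl_list_def numeral_eq_Suc All_less_Suc neighborhood_path_graph
  neighborhood_cycle_graph doubleton_eq_iff card_insert_if

section \<open>Lower bounds for paths and cycles\<close>

lemma not_nl_coloring_path_graph:
  assumes "j \<le> 2" "n \<ge> 2" "j < n"
  shows "\<not> nl_coloring (path_graph n) j P"
proof
  interpret pair_graph "path_graph n" by (rule pair_graph_path_graph)
  assume "nl_coloring (path_graph n) j P"
  moreover have "neighborhood (path_graph n) v \<noteq> {}" if "v < n" for v
    using that \<open>n \<ge> 2\<close> by (simp add: neighborhood_path_graph)
  ultimately have "n = j"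
    using nl_coloring_le_2[of j P] \<open>j \<le> 2\<close> by (simp add: path_graph_def)
  \<comment> \<open>The bound \<open>j < n\<close> matters here: the path of order 2 has an
    NL-coloring with two colors.\<close>
  then show False
    using \<open>j < n\<close> by simp
qed

lemma not_nl_coloring_cycle_graph:
  assumes n: "n \<ge> 3" and j: "j \<le> 2 \<or> j = 3 \<and> even n"
  shows "\<not> nl_coloring (cycle_graph n) j P"
proof
  interpret pair_graph "cycle_graph n" using n by (rule pair_graph_cycle_graph)
  have verts: "pverts (cycle_graph n) = {0..<n}"
    by (simp add: cycle_graph_def)
  have regular: "card (neighborhood (cycle_graph n) v) = 2" if "v \<in> pverts (cycle_graph n)" for v
    using card_neighborhood_cycle_graph[OF n] that verts by simp
  assume P: "nl_coloring (cycle_graph n) j P"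
  show False
    using j
  proof
    assume "j \<le> 2"
    moreover have "neighborhood (cycle_graph n) v \<noteq> {}" if "v \<in> pverts (cycle_graph n)" for v
      using regular[OF that] by auto
    ultimately show False
      using nl_coloring_le_2[OF P] verts n by simp
  next
    assume "j = 3 \<and> even n"
    then show False
      using odd_order_if_2_regular[OF regular] P verts n by simp
  qed
qed

section \<open>Explicit colorings\<close>

lemma nl_coloring_path_2: "\<exists>P. nl_coloring (path_graph 2) 2 P"
  by (rule nl_coloring_path_graph[of _ "[0, 1]"]) (simp_all add: nl_list_simps)

lemma nl_coloring_path_3:
  assumes "n \<in> {3, 4, 5, 6, 7, 8, 9}"
  shows "\<exists>P. nl_coloring (path_graph n) 3 P"
proof -
  have path_3: "\<exists>P. nl_coloring (path_graph 3) 3 P"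
    by (rule nl_coloring_path_graph[of _ "[0, 1, 2]"]) (simp_all add: nl_list_simps)
  have path_4: "\<exists>P. nl_coloring (path_graph 4) 3 P"
    by (rule nl_coloring_path_graph[of _ "[0, 1, 0, 2]"]) (simp_all add: nl_list_simps)
  have path_5: "\<exists>P. nl_coloring (path_graph 5) 3 P"
    by (rule nl_coloring_path_graph[of _ "[0, 1, 0, 2, 0]"]) (simp_all add: nl_list_simps)
  have path_6: "\<exists>P. nl_coloring (path_graph 6) 3 P"
    by (rule nl_coloring_path_graph[of _ "[0, 1, 0, 2, 1, 2]"]) (simp_all add: nl_list_simps)
  have path_7: "\<exists>P. nl_coloring (path_graph 7) 3 P"
    by (rule nl_coloring_path_graph[of _ "[0, 1, 0, 2, 0, 2, 1]"]) (simp_all add: nl_list_simps)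
  have path_8: "\<exists>P. nl_coloring (path_graph 8) 3 P"
    by (rule nl_coloring_path_graph[of _ "[0, 1, 0, 2, 0, 2, 1, 2]"]) (simp_all add: nl_list_simps)
  \<comment> \<open>An extremal case: with three colors a vertex sees one of three nonempty color
    sets, so a class has at most three vertices. Here every class has three.\<close>
  have path_9: "\<exists>P. nl_coloring (path_graph 9) 3 P"
    by (rule nl_coloring_path_graph[of _ "[0, 1, 2, 1, 2, 0, 2, 0, 1]"]) (simp_all add: nl_list_simps)
  show ?thesis
    using assms path_3 path_4 path_5 path_6 path_7 path_8 path_9 by auto
qed

text \<open>The parity argument dictates the witnesses: each class has exactly one vertex that sees
  both other colors, and two colors alternate between consecutive vertices of this kind.\<close>

lemma nl_coloring_cycle_3:
  assumes "n \<in> {3, 5, 7, 9}"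
  shows "\<exists>P. nl_coloring (cycle_graph n) 3 P"
proof -
  have cycle_3: "\<exists>P. nl_coloring (cycle_graph 3) 3 P"
    by (rule nl_coloring_cycle_graph[of _ "[0, 1, 2]"]) (simp_all add: nl_list_simps)
  have cycle_5: "\<exists>P. nl_coloring (cycle_graph 5) 3 P"
    by (rule nl_coloring_cycle_graph[of _ "[0, 1, 0, 1, 2]"]) (simp_all add: nl_list_simps)
  have cycle_7: "\<exists>P. nl_coloring (cycle_graph 7) 3 P"
    by (rule nl_coloring_cycle_graph[of _ "[0, 1, 0, 1, 2, 0, 2]"]) (simp_all add: nl_list_simps)
  have cycle_9: "\<exists>P. nl_coloring (cycle_graph 9) 3 P"
    by (rule nl_coloring_cycle_graph[of _ "[0, 1, 0, 1, 2, 1, 2, 0, 2]"]) (simp_all add: nl_list_simps)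
  show ?thesis
    using assms cycle_3 cycle_5 cycle_7 cycle_9 by auto
qed

text \<open>In each witness color 3 occurs at the last vertex only; seeing it separates the
  neighbors of that vertex from the rest of their classes.\<close>

lemma nl_coloring_cycle_4:
  assumes "n \<in> {4, 6, 8}"
  shows "\<exists>P. nl_coloring (cycle_graph n) 4 P"
proof -
  have cycle_4: "\<exists>P. nl_coloring (cycle_graph 4) 4 P"
    by (rule nl_coloring_cycle_graph[of _ "[0, 1, 2, 3]"]) (simp_all add: nl_list_simps)
  have cycle_6: "\<exists>P. nl_coloring (cycle_graph 6) 4 P"
    by (rule nl_coloring_cycle_graph[of _ "[0, 1, 0, 1, 2, 3]"]) (simp_all add: nl_list_simps)
  have cycle_8: "\<exists>P. nl_coloring (cycle_graph 8) 4 P"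
    by (rule nl_coloring_cycle_graph[of _ "[0, 1, 0, 1, 2, 0, 1, 3]"]) (simp_all add: nl_list_simps)
  show ?thesis
    using assms cycle_4 cycle_6 cycle_8 by auto
qed

section \<open>Values of the neighbor-locating chromatic number\<close>

theorem theorem7:
  "chi_NL (path_graph 2) = 2 \<and>
   (\<forall>n::nat. 3 \<le> n \<and> n \<le> 9 \<longrightarrow> chi_NL (path_graph n) = 3) \<and>
   (\<forall>n::nat. n \<in> {3, 5, 7, 9} \<longrightarrow> chi_NL (cycle_graph n) = 3) \<and>
   (\<forall>n::nat. n \<in> {4, 6, 8} \<longrightarrow> chi_NL (cycle_graph n) = 4)"
proof (intro conjI allI impI)
  obtain P where "nl_coloring (path_graph 2) 2 P"
    using nl_coloring_path_2 by blast
  then show "chi_NL (path_graph 2) = 2"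
    by (rule chi_NL_eqI) (simp add: not_nl_coloring_path_graph)
next
  fix n :: nat
  assume n: "3 \<le> n \<and> n \<le> 9"
  then have "n \<in> {3, 4, 5, 6, 7, 8, 9}"
    by auto
  then obtain P where "nl_coloring (path_graph n) 3 P"
    using nl_coloring_path_3 by blast
  then show "chi_NL (path_graph n) = 3"
    by (rule chi_NL_eqI) (use n in \<open>simp add: not_nl_coloring_path_graph\<close>)
next
  fix n :: nat
  assume n: "n \<in> {3, 5, 7, 9}"
  then obtain P where "nl_coloring (cycle_graph n) 3 P"
    using nl_coloring_cycle_3 by blast
  then show "chi_NL (cycle_graph n) = 3"
    by (rule chi_NL_eqI) (use n in \<open>auto simp: not_nl_coloring_cycle_graph\<close>)
next
  fix n :: nat
  assume n: "n \<in> {4, 6, 8}"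
  then obtain P where "nl_coloring (cycle_graph n) 4 P"
    using nl_coloring_cycle_4 by blast
  then show "chi_NL (cycle_graph n) = 4"
  proof (rule chi_NL_eqI)
    fix j Q
    assume "j < (4::nat)"
    moreover have "n \<ge> 3" "even n"
      using n by auto
    \<comment> \<open>Either \<open>j \<le> 2\<close>, or \<open>j = 3\<close> and the evenness of
      \<open>n\<close> applies.\<close>
    ultimately show "\<not> nl_coloring (cycle_graph n) j Q"
      by (intro not_nl_coloring_cycle_graph) auto
  qed
qed

end
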